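(* The Poisson ideal $\langle\Omega_1-\alpha,\Omega_2-\beta\rangle$ is Poisson primitive in $\mathcal{A}$ for each $(\alpha,\beta)\in\mathbb{K}^2\setminus\{(0,0)\}$.
   Context: $\mathbb{K}$ is a field of characteristic zero. $\mathcal{A}=\mathbb{K}[X_1,\ldots,X_6]$ is the polynomial algebra with the Poisson bracket $\{X_2,X_1\}=-3X_1X_2$, $\{X_3,X_1\}=-X_1X_3-X_2$, $\{X_3,X_2\}=-3X_2X_3$, $\{X_4,X_1\}=-2X_3^2$, $\{X_4,X_2\}=-3X_2X_4-4X_3^3$, $\{X_4,X_3\}=-3X_3X_4$, $\{X_5,X_1\}=X_1X_5-2X_3$, $\{X_5,X_2\}=-6X_3^2$, $\{X_5,X_3\}=-X_3X_5-3X_4$, $\{X_5,X_4\}=-3X_4X_5$, $\{X_6,X_1\}=3X_1X_6-3X_5$, $\{X_6,X_2\}=3X_2X_6+9X_4-18X_3X_5$, $\{X_6,X_3\}=-6X_5^2$, $\{X_6,X_4\}=-3X_4X_6-4X_5^3$, $\{X_6,X_5\}=-3X_5X_6$. $\Omega_1=X_1X_3X_5-\frac32X_1X_4-\frac12X_2X_5+\frac12X_3^2$ and $\Omega_2=X_2X_4X_6-\frac23X_3^3X_6-\frac23X_2X_5^3+2X_3^2X_5^2-3X_3X_4X_5+\frac32X_4^2$ (both Poisson central). $\langle\cdot\rangle$ denotes the ideal of $\mathcal{A}$ generated by the listed elements. A Poisson ideal is an ideal $I$ with $\{\mathcal{A},I\}\subseteq I$; a Poisson prime ideal of $\mathcal{A}$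 is a Poisson ideal that is also a prime ideal. A Poisson primitive ideal is the largest Poisson prime ideal contained in some maximal ideal of $\mathcal{A}$. *)

theory Defs
  imports "HOL-Library.Poly_Mapping" "HOL-Algebra.Algebraic_Closure_Type"
begin

section \<open>The polynomial algebra in six variables\<close>

datatype idx = I1 | I2 | I3 | I4 | I5 | I6

lemma UNIV_idx: "(UNIV :: idx set) = {I1, I2, I3, I4, I5, I6}"
  using idx.exhaust by blast

instance idx :: finite
  by standard (simp add: UNIV_idx)

text \<open>
  A polynomial is a finitely supported map from exponent vectors to coefficients; on this type
  \<^const>\<open>times\<close> is the convolution product.
\<close>
type_synonym 'k pol = "(idx \<Rightarrow>\<^sub>0 nat) \<Rightarrow>\<^sub>0 'k"

definition Const :: "'k::field_char_0 \<Rightarrow> 'k pol" where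
  "Const c = Poly_Mapping.single 0 c"

definition Var :: "idx \<Rightarrow> 'k::field_char_0 pol" where
  "Var i = Poly_Mapping.single (Poly_Mapping.single i 1) 1"

abbreviation "X1 \<equiv> Var I1"
abbreviation "X2 \<equiv> Var I2"
abbreviation "X3 \<equiv> Var I3"
abbreviation "X4 \<equiv> Var I4"
abbreviation "X5 \<equiv> Var I5"
abbreviation "X6 \<equiv> Var I6"

abbreviation polA :: "'k::field_char_0 pol ring" where
  "polA \<equiv> ring_of_type_algebra"


section \<open>The Poisson bracket\<close>

text \<open>
  Formal partial derivative. If the exponent of variable \<open>i\<close> in \<open>m\<close> is zero, the truncated
  subtraction is harmless because the coefficient vanishes.
\<close>
definition pdiff :: "idx \<Rightarrow> 'k::field_char_0 pol \<Rightarrow> 'k pol" where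
  "pdiff i p = (\<Sum>m\<in>Poly_Mapping.keys p.
     Poly_Mapping.single (m - Poly_Mapping.single i 1)
       (of_nat (Poly_Mapping.lookup m i) * Poly_Mapping.lookup p m))"

text \<open>The prescribed values \<open>{X\<^sub>i, X\<^sub>j}\<close> for \<open>i > j\<close>, and zero otherwise.\<close>
fun low_bracket :: "idx \<Rightarrow> idx \<Rightarrow> 'k::field_char_0 pol" where
  "low_bracket I2 I1 = - 3 * X1 * X2"
| "low_bracket I3 I1 = - X1 * X3 - X2"
| "low_bracket I3 I2 = - 3 * X2 * X3"
| "low_bracket I4 I1 = - 2 * X3 ^ 2"
| "low_bracket I4 I2 = - 3 * X2 * X4 - 4 * X3 ^ 3"
| "low_bracket I4 I3 = - 3 * X3 * X4"
| "low_bracket I5 I1 = X1 * X5 - 2 * X3"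
| "low_bracket I5 I2 = - 6 * X3 ^ 2"
| "low_bracket I5 I3 = - X3 * X5 - 3 * X4"
| "low_bracket I5 I4 = - 3 * X4 * X5"
| "low_bracket I6 I1 = 3 * X1 * X6 - 3 * X5"
| "low_bracket I6 I2 = 3 * X2 * X6 + 9 * X4 - 18 * X3 * X5"
| "low_bracket I6 I3 = - 6 * X5 ^ 2"
| "low_bracket I6 I4 = - 3 * X4 * X6 - 4 * X5 ^ 3"
| "low_bracket I6 I5 = - 3 * X5 * X6"
| "low_bracket _ _ = 0"

definition gen_bracket :: "idx \<Rightarrow> idx \<Rightarrow> 'k::field_char_0 pol" where
  "gen_bracket i j = low_bracket i j - low_bracket j i"

text \<open>The unique bilinear biderivation taking the prescribed values on the variables.\<close>
definition bracket :: "'k::field_char_0 pol \<Rightarrow> 'k pol \<Rightarrow> 'k pol" where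
  "bracket f g = (\<Sum>i\<in>UNIV. \<Sum>j\<in>UNIV. pdiff i f * pdiff j g * gen_bracket i j)"

lemma pdiff_Var: "pdiff i (Var j) = (if i = j then 1 else 0)"
  by (auto simp: pdiff_def Var_def lookup_single when_def single_one)

lemma bracket_Var: "bracket (Var i) (Var j) = gen_bracket i j"
  by (cases i; cases j) (simp_all add: bracket_def pdiff_Var UNIV_idx)


section \<open>Poisson ideals\<close>

definition poisson_ideal :: "'k::field_char_0 pol set \<Rightarrow> bool" where
  "poisson_ideal I \<longleftrightarrow> ideal I polA \<and> (\<forall>a. \<forall>x\<in>I. bracket a x \<in> I)"

definition poisson_prime :: "'k::field_char_0 pol set \<Rightarrow> bool" where
  "poisson_prime P \<longleftrightarrow> poisson_ideal P \<and> primeideal P polA"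

definition poisson_primitive :: "'k::field_char_0 pol set \<Rightarrow> bool" where
  "poisson_primitive P \<longleftrightarrow>
     (\<exists>M. maximalideal M polA \<and> poisson_prime P \<and> P \<subseteq> M \<and>
          (\<forall>Q. poisson_prime Q \<and> Q \<subseteq> M \<longrightarrow> Q \<subseteq> P))"


section \<open>The central elements\<close>

definition Omega1 :: "'k::field_char_0 pol" where
  "Omega1 = X1 * X3 * X5 - Const (3/2) * X1 * X4 - Const (1/2) * X2 * X5 + Const (1/2) * X3 ^ 2"

definition Omega2 :: "'k::field_char_0 pol" where
  "Omega2 = X2 * X4 * X6 - Const (2/3) * X3 ^ 3 * X6 - Const (2/3) * X2 * X5 ^ 3
     + 2 * X3 ^ 2 * X5 ^ 2 - 3 * X3 * X4 * X5 + Const (3/2) * X4 ^ 2"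

end

theory Submission
  imports Defs
begin

text \<open>
  Write \<open>P\<close> for the ideal generated by \<open>\<Omega>\<^sub>1 - \<alpha>\<close> and \<open>\<Omega>\<^sub>2 - \<beta>\<close>. The generators are affine in one
  variable each: \<open>2 (\<Omega>\<^sub>1 - \<alpha>) = c X\<^sub>1 + d\<close> and \<open>6 (\<Omega>\<^sub>2 - \<beta>) = a X\<^sub>6 + b\<close>, where \<open>a, b, c, d\<close>
  involve only \<open>X\<^sub>2, \<dots>, X\<^sub>5\<close>. So wherever \<open>a\<close> and \<open>c\<close> do not vanish, \<open>X\<^sub>2, \<dots>, X\<^sub>5\<close> are coordinates on the variety of \<open>P\<close>.

  \<^emph>\<open>Primality.\<close> The localisation of the quotient by \<open>P\<close> at \<open>a c\<close> embeds in a field of rational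
  functions, so what matters is that nothing is lost in localising. This is the content of
  \<open>ideal_linear_pair_prime\<close>: over a domain, \<open>c X + d\<close> generates a prime ideal once \<open>d\<close> is a
  non-zero-divisor modulo \<open>c\<close>. It is applied first to \<open>a X\<^sub>6 + b\<close>, where \<open>a\<close> is prime and does not
  divide \<open>b\<close>, and then to \<open>c X\<^sub>1 + d\<close> modulo \<open>a X\<^sub>6 + b\<close>. In the second step the condition on \<open>d\<close>
  comes down to an explicit element (\<open>defect\<close>) lying outside the prime ideal generated by \<open>c\<close> and
  \<open>d\<close>, and this is the place where \<open>(\<alpha>, \<beta>) \<noteq> (0, 0)\<close> enters.

  \<^emph>\<open>Primitivity.\<close> The generators are Poisson central, so \<open>P\<close> is a Poisson ideal. Take for \<open>M\<close> the
  maximal ideal of a rational point \<open>p\<close> of the variety of \<open>P\<close> at which \<open>a\<close> and \<open>c\<close> do not vanish.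
  The Pfaffian of the matrix \<open>({X\<^sub>i, X\<^sub>j})\<close> with \<open>2 \<le> i, j \<le> 5\<close> is \<open>a c / 2\<close>, so the Hamiltonian
  vector fields span the tangent space of the variety at \<open>p\<close>. Hence every element of a Poisson ideal
  inside \<open>M\<close> vanishes to infinite order at \<open>p\<close> along the variety, and so lies in \<open>P\<close>. In algebraic
  terms (\<open>indep_in_poisson_ideal_imp_zero\<close>): the polynomials in \<open>X\<^sub>2, \<dots>, X\<^sub>5\<close> which some element
  not vanishing at \<open>p\<close> multiplies into a given Poisson ideal inside \<open>M\<close> form a set closed under
  partial derivatives; if that set had a nonzero element, repeated differentiation would produce
  a nonzero constant in it, which is absurd at \<open>p\<close>. Any \<open>f\<close> in a Poisson prime ideal inside \<open>M\<close>
  reduces modulo \<open>P\<close>, after multiplication by powers of \<open>a\<close> and \<open>c\<close>, to such a polynomial, which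
  must therefore be zero; as \<open>P\<close> is prime, \<open>f\<close> lies in \<open>P\<close>.
\<close>


section \<open>Polynomials, derivatives and evaluation\<close>

text \<open>
  Any linear order on the variables makes exponent vectors a linearly ordered cancellative monoid
  (lexicographically), and comparing leading monomials then makes the polynomials an integral
  domain.
\<close>
instantiation idx :: linorder
begin

definition less_eq_idx :: "idx \<Rightarrow> idx \<Rightarrow> bool" where
  "i \<le> j \<longleftrightarrow> (case_idx 1 2 3 4 5 6 i :: nat) \<le> case_idx 1 2 3 4 5 6 j"

definition less_idx :: "idx \<Rightarrow> idx \<Rightarrow> bool" where
  "i < j \<longleftrightarrow> (case_idx 1 2 3 4 5 6 i :: nat) < case_idx 1 2 3 4 5 6 j"

instance
  by standard (auto simp: less_eq_idx_def less_idx_def split: idx.splits)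

end

lemma pol_sum_induct [case_names single add]:
  fixes f :: "'k::field_char_0 pol"
  assumes "\<And>m c. P (Poly_Mapping.single m c)" and "\<And>f g. P f \<Longrightarrow> P g \<Longrightarrow> P (f + g)"
  shows "P f"
proof (induction f rule: update_induct)
  case const
  show ?case using assms(1)[of 0 0] by simp
next
  case (update f m c)
  have "Poly_Mapping.update m c f = f + Poly_Mapping.single m c"
    using update(1)
    by (intro poly_mapping_eqI)
      (auto simp: lookup_update lookup_add lookup_single when_def in_keys_iff)
  then show ?case using assms update.IH by simp
qed

lemma Const_0 [simp]: "Const 0 = 0" and Const_1 [simp]: "Const 1 = 1"
  and Const_minus: "Const (- x) = - Const x"
  and Const_mult: "Const (x * y) = Const x * Const y"
  and Const_numeral [simp]: "Const (numeral n) = numeral n"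
  by (simp_all add: Const_def single_add single_diff single_uminus mult_single flip: single_one)

lemma pol_induct [case_names Const Var add mult]:
  fixes f :: "'k::field_char_0 pol"
  assumes Const: "\<And>c. P (Const c)" and Var: "\<And>i. P (Var i)"
    and add: "\<And>f g. P f \<Longrightarrow> P g \<Longrightarrow> P (f + g)"
    and mult: "\<And>f g. P f \<Longrightarrow> P g \<Longrightarrow> P (f * g)"
  shows "P f"
proof (induction f rule: pol_sum_induct)
  case (single m c)
  show ?case
  proof (induction m rule: update_induct)
    case const
    show ?case using Const[of c] by (simp add: Const_def)
  next
    case (update m i n)
    have *: "Poly_Mapping.single (Poly_Mapping.single i n) 1 = (Var i ^ n :: 'k pol)" for n
    proof (induction n)
      case (Suc n)
      have "Poly_Mapping.single i (Suc n) = Poly_Mapping.single i 1 + Poly_Mapping.single i n"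
        by (simp flip: single_add)
      then show ?case
        by (simp only: power_Suc Suc[symmetric]) (simp add: Var_def mult_single)
    qed simp
    have "P (Var i ^ n)" for n
      by (induction n) (use Const[of 1] Var mult in auto)
    moreover have "Poly_Mapping.update i n m = Poly_Mapping.single i n + m"
      using update(1)
      by (intro poly_mapping_eqI)
        (auto simp: lookup_update lookup_add lookup_single when_def in_keys_iff)
    then have "Poly_Mapping.single (Poly_Mapping.update i n m) c = Var i ^ n * Poly_Mapping.single m c"
      by (simp add: mult_single flip: *)
    ultimately show ?case using mult update.IH by simp
  qed
qed (rule add)

lemma lookup_pdiff:
  "Poly_Mapping.lookup (pdiff i p) m =
     of_nat (Poly_Mapping.lookup m i + 1) * Poly_Mapping.lookup p (m + Poly_Mapping.single i 1)"
proof -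
  let ?e = "Poly_Mapping.single i 1 :: idx \<Rightarrow>\<^sub>0 nat"
  (* The side condition excludes the monomials for which subtraction truncates. *)
  have iff: "n - ?e = m \<and> Poly_Mapping.lookup n i \<noteq> 0 \<longleftrightarrow> n = m + ?e" for n
  proof
    assume *: "n - ?e = m \<and> Poly_Mapping.lookup n i \<noteq> 0"
    show "n = m + ?e"
    proof (rule poly_mapping_eqI)
      fix k
      show "Poly_Mapping.lookup n k = Poly_Mapping.lookup (m + ?e) k"
        using * by (auto simp: lookup_add lookup_minus lookup_single when_def)
    qed
  qed (simp add: lookup_add)
  have "Poly_Mapping.lookup (pdiff i p) m =
      (\<Sum>n\<in>Poly_Mapping.keys p. if n = m + ?e
        then of_nat (Poly_Mapping.lookup n i) * Poly_Mapping.lookup p n else 0)"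
    unfolding pdiff_def lookup_sum lookup_single
  proof (intro sum.cong refl)
    fix n
    show "(of_nat (Poly_Mapping.lookup n i) * Poly_Mapping.lookup p n when n - ?e = m) =
        (if n = m + ?e then of_nat (Poly_Mapping.lookup n i) * Poly_Mapping.lookup p n else 0)"
      using iff[of n] by (cases "Poly_Mapping.lookup n i = 0"; cases "n - ?e = m") auto
  qed
  also have "\<dots> = of_nat (Poly_Mapping.lookup m i + 1) * Poly_Mapping.lookup p (m + ?e)"
    by (simp add: sum.delta in_keys_iff lookup_add)
  finally show ?thesis .
qed

lemma pdiff_single:
  "pdiff i (Poly_Mapping.single m c) =
     Poly_Mapping.single (m - Poly_Mapping.single i 1) (of_nat (Poly_Mapping.lookup m i) * c)"
  by (simp add: pdiff_def)

lemma pdiff_add [simp]: "pdiff i (f + g) = pdiff i f + pdiff i g"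
  and pdiff_minus [simp]: "pdiff i (- f) = - pdiff i f"
  and pdiff_diff [simp]: "pdiff i (f - g) = pdiff i f - pdiff i g"
  by (intro poly_mapping_eqI; simp add: lookup_pdiff lookup_add lookup_minus algebra_simps)+

lemma pdiff_Const [simp]: "pdiff i (Const c) = 0"
  by (simp add: Const_def pdiff_single)

lemma pdiff_zero [simp]: "pdiff i 0 = 0" and pdiff_one [simp]: "pdiff i 1 = 0"
  and pdiff_numeral [simp]: "pdiff i (numeral n) = 0"
  using pdiff_Const[of i 0] pdiff_Const[of i 1] pdiff_Const[of i "numeral n"] by simp_all

lemma pdiff_of_nat [simp]: "pdiff i (of_nat n) = 0"
  by (induction n) auto

lemma pdiff_mult: "pdiff i (f * g) = f * pdiff i g + pdiff i f * g"
proof (induction f rule: pol_sum_induct)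
  case (single m c)
  show ?case
  proof (induction g rule: pol_sum_induct)
    case (single n d)
    let ?e = "Poly_Mapping.single i 1 :: idx \<Rightarrow>\<^sub>0 nat"
    have 1: "m + (n - ?e) = m + n - ?e" if "Poly_Mapping.lookup n i \<noteq> 0"
      using that by (intro poly_mapping_eqI) (auto simp: lookup_add lookup_minus lookup_single when_def)
    have 2: "m - ?e + n = m + n - ?e" if "Poly_Mapping.lookup m i \<noteq> 0"
      using that by (intro poly_mapping_eqI) (auto simp: lookup_add lookup_minus lookup_single when_def)
    have 3: "Poly_Mapping.single (m + (n - ?e)) (c * (of_nat (Poly_Mapping.lookup n i) * d)) =
        Poly_Mapping.single (m + n - ?e) (c * (of_nat (Poly_Mapping.lookup n i) * d))"
      using 1 by (cases "Poly_Mapping.lookup n i = 0") (simp, metis)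
    have 4: "Poly_Mapping.single (m - ?e + n) (of_nat (Poly_Mapping.lookup m i) * c * d) =
        Poly_Mapping.single (m + n - ?e) (of_nat (Poly_Mapping.lookup m i) * c * d)"
      using 2 by (cases "Poly_Mapping.lookup m i = 0") (simp, metis)
    show ?case
      unfolding mult_single pdiff_single 3 4
      by (simp add: lookup_add algebra_simps flip: single_add)
  qed (simp add: algebra_simps)
qed (simp add: algebra_simps)

lemma pdiff_power: "pdiff i (f ^ n) = of_nat n * f ^ (n - 1) * pdiff i f"
proof (induction n)
  case (Suc n)
  then show ?case by (cases n) (simp_all add: pdiff_mult algebra_simps)
qed simp

lemma pdiff_commute: "pdiff i (pdiff j f) = pdiff j (pdiff i f)"
  by (intro poly_mapping_eqI) (auto simp: lookup_pdiff lookup_add lookup_single when_def algebra_simps)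

text \<open>The total degree; the inserted \<open>0\<close> is the value at the zero polynomial.\<close>

definition tdeg :: "'k::field_char_0 pol \<Rightarrow> nat" where
  "tdeg f = Max (insert 0 ((\<lambda>m. \<Sum>i\<in>UNIV. Poly_Mapping.lookup m i) ` Poly_Mapping.keys f))"

lemma tdeg_pdiff_less:
  assumes "pdiff i f \<noteq> 0"
  shows "tdeg (pdiff i f) < tdeg f"
proof -
  let ?s = "\<lambda>m :: idx \<Rightarrow>\<^sub>0 nat. \<Sum>i\<in>UNIV. Poly_Mapping.lookup m i"
  let ?e = "Poly_Mapping.single i 1 :: idx \<Rightarrow>\<^sub>0 nat"
  have le: "?s m < tdeg f" if "m \<in> Poly_Mapping.keys (pdiff i f)" for m
  proof -
    have "m + ?e \<in> Poly_Mapping.keys f"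
      using that by (auto simp: in_keys_iff lookup_pdiff)
    then have "?s (m + ?e) \<le> tdeg f"
      unfolding tdeg_def by (intro Max_ge) auto
    moreover have "?s (m + ?e) = ?s m + 1"
      by (simp add: lookup_add sum.distrib lookup_single when_def)
    ultimately show ?thesis by simp
  qed
  obtain m where "m \<in> Poly_Mapping.keys (pdiff i f)"
    using assms by (metis ex_in_conv keys_eq_empty)
  then have "0 < tdeg f" using le by fastforce
  then show ?thesis
    unfolding tdeg_def[of "pdiff i f"] using le by (subst Max_less_iff) auto
qed

text \<open>Differentiating lowers the degree, so it can be repeated only finitely often without reaching zero.\<close>

lemma ex_nonzero_with_all_pdiff_zero:
  assumes "f \<noteq> 0" "S f" "\<And>i g. i \<in> V \<Longrightarrow> S g \<Longrightarrow> S (pdiff i g)"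
  shows "\<exists>g. S g \<and> g \<noteq> 0 \<and> (\<forall>i\<in>V. pdiff i g = 0)"
  using assms(1,2)
proof (induction "tdeg f" arbitrary: f rule: less_induct)
  case less
  then show ?case
    using assms(3) tdeg_pdiff_less by (cases "\<forall>i\<in>V. pdiff i f = 0") blast+
qed

lemma eq_Const_if_all_pdiff_zero:
  assumes "\<And>i. pdiff i f = 0"
  shows "f = Const (Poly_Mapping.lookup f 0)"
proof (rule poly_mapping_eqI)
  fix m
  show "Poly_Mapping.lookup f m = Poly_Mapping.lookup (Const (Poly_Mapping.lookup f 0)) m"
  proof (cases "m = 0")
    case False
    then obtain i where i: "Poly_Mapping.lookup m i \<noteq> 0"
      by (metis lookup_zero poly_mapping_eqI)
    let ?e = "Poly_Mapping.single i 1 :: idx \<Rightarrow>\<^sub>0 nat"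
    have m: "m = (m - ?e) + ?e"
      using i by (intro poly_mapping_eqI) (auto simp: lookup_add lookup_minus lookup_single when_def)
    have "of_nat (Poly_Mapping.lookup (m - ?e) i + 1) * Poly_Mapping.lookup f m = 0"
      using lookup_pdiff[of i f "m - ?e"] assms[of i] m by simp
    then have "Poly_Mapping.lookup f m = 0"
      by (metis Suc_eq_plus1 mult_eq_0_iff of_nat_eq_0_iff nat.distinct(2))
    then show ?thesis using False by (simp add: Const_def lookup_single)
  qed (simp add: Const_def)
qed

definition ev :: "(idx \<Rightarrow> 'k) \<Rightarrow> 'k::field_char_0 pol \<Rightarrow> 'k" where
  "ev p f = (\<Sum>m\<in>Poly_Mapping.keys f.
     Poly_Mapping.lookup f m * (\<Prod>i\<in>UNIV. p i ^ Poly_Mapping.lookup m i))"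

lemma ev_single: "ev p (Poly_Mapping.single m c) = c * (\<Prod>i\<in>UNIV. p i ^ Poly_Mapping.lookup m i)"
  by (simp add: ev_def)

lemma ev_add [simp]: "ev p (f + g) = ev p f + ev p g"
  unfolding ev_def by (rule setsum_keys_plus_distrib) (simp_all add: algebra_simps)

lemma ev_mult [simp]: "ev p (f * g) = ev p f * ev p g"
proof (induction f rule: pol_sum_induct)
  case (single m c)
  show ?case
    by (induction g rule: pol_sum_induct)
      (simp_all add: mult_single ev_single lookup_add power_add prod.distrib algebra_simps)
qed (simp add: algebra_simps)

lemma ev_Const [simp]: "ev p (Const c) = c"
  by (simp add: Const_def ev_single)

lemma ev_zero [simp]: "ev p 0 = 0" and ev_one [simp]: "ev p 1 = 1"
  and ev_numeral [simp]: "ev p (numeral n) = numeral n"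
  using ev_Const[of p 0] ev_Const[of p 1] ev_Const[of p "numeral n"] by simp_all

lemma ev_minus [simp]: "ev p (- f) = - ev p f"
  using ev_add[of p f "- f"] by (simp add: eq_neg_iff_add_eq_0 add.commute)

lemma ev_diff [simp]: "ev p (f - g) = ev p f - ev p g"
  using ev_add[of p f "- g"] by simp

lemma ev_power [simp]: "ev p (f ^ n) = ev p f ^ n"
  by (induction n) auto

lemma ev_Var [simp]: "ev p (Var i) = p i"
proof -
  have "(\<Prod>j\<in>UNIV. p j ^ Poly_Mapping.lookup (Poly_Mapping.single i (1::nat)) j) = (\<Prod>j\<in>UNIV. if j = i then p j else 1)"
    by (intro prod.cong) (auto simp: lookup_single when_def)
  then show ?thesis by (simp add: Var_def ev_single)
qed


section \<open>Ideals\<close>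

lemma polA_simps [simp]:
  "carrier polA = UNIV" "x \<otimes>\<^bsub>polA\<^esub> y = x * y" "x \<oplus>\<^bsub>polA\<^esub> y = x + y"
  "\<zero>\<^bsub>polA\<^esub> = 0" "\<one>\<^bsub>polA\<^esub> = 1"
  by (simp_all add: ring_of_type_algebra_def)

lemma ideal_polA_iff:
  "ideal I polA \<longleftrightarrow>
     0 \<in> I \<and> (\<forall>x\<in>I. \<forall>y\<in>I. x + y \<in> I) \<and> (\<forall>a. \<forall>x\<in>I. a * x \<in> (I :: 'k::field_char_0 pol set))"
proof
  assume "ideal I polA"
  then interpret ideal I polA .
  show "0 \<in> I \<and> (\<forall>x\<in>I. \<forall>y\<in>I. x + y \<in> I) \<and> (\<forall>a. \<forall>x\<in>I. a * x \<in> I)"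
    using I_l_closed additive_subgroup.a_closed[OF is_additive_subgroup]
      additive_subgroup.zero_closed[OF is_additive_subgroup]
    by simp
next
  assume I: "0 \<in> I \<and> (\<forall>x\<in>I. \<forall>y\<in>I. x + y \<in> I) \<and> (\<forall>a. \<forall>x\<in>I. a * x \<in> I)"
  interpret ring "polA :: 'k pol ring" by (rule ring_from_type_algebra)
  have minus: "\<ominus>\<^bsub>polA\<^esub> x = - x" for x :: "'k pol"
    using add.inv_equality[of "- x" x] by (simp add: a_inv_def)
  have neg: "- x \<in> I" if "x \<in> I" for x
    using I that by (metis mult_minus1)
  show "ideal I polA"
  proof (rule idealI[OF ring_axioms])
    show "subgroup I (add_monoid polA)"
      by (rule add.subgroupI) (use I neg minus in \<open>auto simp: a_inv_def\<close>)
    fix a x assume "a \<in> I"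
    then have "x * a \<in> I" using I by blast
    then show "x \<otimes>\<^bsub>polA\<^esub> a \<in> I" "a \<otimes>\<^bsub>polA\<^esub> x \<in> I" by (simp_all add: mult.commute)
  qed
qed

lemma mem_Idl_pair:
  "f \<in> Idl\<^bsub>polA\<^esub> {u, w} \<longleftrightarrow> (\<exists>x y. f = x * u + y * (w :: 'k::field_char_0 pol))"
proof
  interpret ring "polA :: 'k pol ring" by (rule ring_from_type_algebra)
  have id: "ideal (Idl\<^bsub>polA\<^esub> {u, w}) polA"
    by (rule genideal_ideal) simp
  have "u \<in> Idl\<^bsub>polA\<^esub> {u, w}" "w \<in> Idl\<^bsub>polA\<^esub> {u, w}"
    using genideal_self[of "{u, w}"] by auto
  then show "f \<in> Idl\<^bsub>polA\<^esub> {u, w}" if "\<exists>x y. f = x * u + y * w"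
    using that id unfolding ideal_polA_iff by auto
  have "ideal {f. \<exists>x y. f = x * u + y * w} polA"
    unfolding ideal_polA_iff
  proof (intro conjI ballI allI)
    show "0 \<in> {f. \<exists>x y. f = x * u + y * w}"
      by (rule CollectI, rule exI[of _ 0], rule exI[of _ 0]) simp
  next
    fix f g assume "f \<in> {f. \<exists>x y. f = x * u + y * w}" "g \<in> {f. \<exists>x y. f = x * u + y * w}"
    then obtain x y x' y' where "f = x * u + y * w" "g = x' * u + y' * w" by auto
    then have "f + g = (x + x') * u + (y + y') * w" by (simp add: algebra_simps)
    then show "f + g \<in> {f. \<exists>x y. f = x * u + y * w}" by blast
  next
    fix a f assume "f \<in> {f. \<exists>x y. f = x * u + y * w}"
    then obtain x y where "f = x * u + y * w" by auto
    then have "a * f = (a * x) * u + (a * y) * w" by (simp add: algebra_simps)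
    then show "a * f \<in> {f. \<exists>x y. f = x * u + y * w}" by blast
  qed
  moreover have "{u, w} \<subseteq> {f. \<exists>x y. f = x * u + y * w}"
  proof -
    have "u = 1 * u + 0 * w" "w = 0 * u + 1 * w" by simp_all
    then show ?thesis by blast
  qed
  ultimately show "\<exists>x y. f = x * u + y * w" if "f \<in> Idl\<^bsub>polA\<^esub> {u, w}"
    using genideal_minimal[of "{f. \<exists>x y. f = x * u + y * w}" "{u, w}"] that by blast
qed


section \<open>Eliminating variables\<close>

text \<open>
  In characteristic zero a polynomial does not involve \<open>X\<^sub>i\<close> if and only if its derivative by \<open>X\<^sub>i\<close>
  vanishes. Taking this as the definition makes closure under the ring operations immediate and
  avoids degrees in a single variable.
\<close>

definition indep :: "idx set \<Rightarrow> 'k::field_char_0 pol \<Rightarrow> bool" where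
  "indep V f \<longleftrightarrow> (\<forall>i\<in>V. pdiff i f = 0)"

lemma indep_simps [simp]:
  "indep V (Const c)" "indep V 0" "indep V 1" "indep V (numeral k)"
  "indep V f \<Longrightarrow> indep V g \<Longrightarrow> indep V (f + g)"
  "indep V f \<Longrightarrow> indep V g \<Longrightarrow> indep V (f - g)"
  "indep V f \<Longrightarrow> indep V (- f)"
  "indep V f \<Longrightarrow> indep V g \<Longrightarrow> indep V (f * g)"
  "indep V f \<Longrightarrow> indep V (f ^ n)"
  "i \<notin> V \<Longrightarrow> indep V (Var i)"
  by (auto simp: indep_def pdiff_mult pdiff_power pdiff_Var)

text \<open>
  If each variable of \<open>V\<close> is congruent modulo \<open>I\<close> to a fraction with denominator in \<open>S\<close> and free of
  \<open>V\<close>, then so is every polynomial, because such fractions are closed under sums and products.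
\<close>

lemma pseudo_division:
  assumes I: "ideal I polA"
    and S: "1 \<in> S" "\<And>s t. s \<in> S \<Longrightarrow> t \<in> S \<Longrightarrow> s * t \<in> S" "\<And>s. s \<in> S \<Longrightarrow> indep V s"
    and Var: "\<And>i. i \<in> V \<Longrightarrow> \<exists>s\<in>S. \<exists>r. indep V r \<and> s * Var i - r \<in> I"
  shows "\<exists>s\<in>S. \<exists>r. indep V r \<and> s * f - r \<in> (I :: 'k::field_char_0 pol set)"
proof (induction f rule: pol_induct)
  case (Const c)
  show ?case using S(1) I unfolding ideal_polA_iff by (intro bexI[of _ 1] exI[of _ "Const c"]) auto
next
  case (Var i)
  show ?case
  proof (cases "i \<in> V")
    case False
    then show ?thesis
      using S(1) I unfolding ideal_polA_iff by (intro bexI[of _ 1] exI[of _ "Var i"]) auto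
  qed (rule assms)
next
  case (add f g)
  then obtain s r t q where *: "s \<in> S" "indep V r" "s * f - r \<in> I" "t \<in> S" "indep V q" "t * g - q \<in> I"
    by blast
  have "s * t * (f + g) - (t * r + s * q) = t * (s * f - r) + s * (t * g - q)"
    by (simp add: algebra_simps)
  also have "\<dots> \<in> I" using * I unfolding ideal_polA_iff by blast
  finally have "s * t * (f + g) - (t * r + s * q) \<in> I" .
  then show ?case
    using * S(2,3) by (intro bexI[of _ "s * t"] exI[of _ "t * r + s * q"]) simp_all
next
  case (mult f g)
  then obtain s r t q where *: "s \<in> S" "indep V r" "s * f - r \<in> I" "t \<in> S" "indep V q" "t * g - q \<in> I"
    by blast
  have "s * t * (f * g) - r * q = (t * g) * (s * f - r) + r * (t * g - q)"
    by (simp add: algebra_simps)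
  also have "\<dots> \<in> I" using * I unfolding ideal_polA_iff by blast
  finally have "s * t * (f * g) - r * q \<in> I" .
  then show ?case
    using * S(2,3) by (intro bexI[of _ "s * t"] exI[of _ "r * q"]) simp_all
qed

text \<open>
  A multiple of \<open>u = c X\<^sub>i + d\<close> involves \<open>X\<^sub>i\<close> unless it is zero. With \<open>z'\<close> the derivative of \<open>z\<close>,
  the hypothesis reads \<open>u z' + c z = 0\<close>, and differentiating it \<open>n\<close> times gives the same kind of
  relation \<open>u z' + (n + 1) c z = 0\<close> for the \<open>n\<close>th derivative in place of \<open>z\<close>. For the last nonzero
  derivative the first summand vanishes, which is a contradiction.
\<close>

lemma linear_mult_free_imp_zero:
  assumes "pdiff i c = 0" "pdiff i d = 0" "c \<noteq> 0" "pdiff i ((c * Var i + d) * z) = 0"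
  shows "z = (0 :: 'k::field_char_0 pol)"
proof -
  let ?u = "c * Var i + d"
  have u: "pdiff i ?u = c" using assms by (simp add: pdiff_mult pdiff_Var)
  have "z = 0" if "?u * pdiff i z + of_nat (Suc n) * c * z = 0" for n
    using that
  proof (induction "tdeg z" arbitrary: z n rule: less_induct)
    case less
    show ?case
    proof (cases "pdiff i z = 0")
      case True
      then have "of_nat (Suc n) * c * z = 0" using less.prems by simp
      then show ?thesis using assms(3) by (metis mult_eq_0_iff of_nat_eq_0_iff nat.distinct(2))
    next
      case False
      have "0 = pdiff i (?u * pdiff i z + of_nat (Suc n) * c * z)"
        using less.prems by simp
      also have "\<dots> = ?u * pdiff i (pdiff i z) + c * pdiff i z + of_nat (Suc n) * c * pdiff i z"
        by (simp add: pdiff_mult pdiff_Var assms algebra_simps del: of_nat_Suc)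
      also have "\<dots> = ?u * pdiff i (pdiff i z) + of_nat (Suc (Suc n)) * c * pdiff i z"
        by (simp add: algebra_simps)
      finally have "pdiff i z = 0"
        using less.hyps[OF tdeg_pdiff_less[OF False]] by metis
      with False show ?thesis by simp
    qed
  qed
  from this[of 0] show ?thesis
    using assms(4) unfolding pdiff_mult[of i ?u] u by simp
qed

text \<open>
  In the domain \<open>D\<close> of \<open>X\<^sub>i\<close>-free polynomials modulo \<open>w\<close>, inverting \<open>c\<close> turns the quotient
  \<open>D[X\<^sub>i]/(c X\<^sub>i + d)\<close> into \<open>D[1/c]\<close>, a domain. The hypothesis that \<open>d\<close> is a non-zero-divisor modulo
  \<open>(c, w)\<close> makes \<open>c\<close> a non-zero-divisor modulo \<open>(u, w)\<close>, so that the quotient embeds in this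
  localisation; \<open>c\<close> is nonzero in \<open>D\<close> because \<open>w\<close> does not divide it. The case \<open>w = 0\<close> is allowed, so
  that the lemma also covers principal ideals.
\<close>

lemma ideal_linear_pair_prime:
  fixes i :: idx and c d w :: "'k::field_char_0 pol"
  defines "u \<equiv> c * Var i + d"
  assumes free: "pdiff i c = 0" "pdiff i d = 0" "pdiff i w = 0"
    and w: "w = 0 \<or> prime_elem w" "\<not> w dvd c"
    and reg: "\<And>z. d * z \<in> Idl\<^bsub>polA\<^esub> {c, w} \<Longrightarrow> z \<in> Idl\<^bsub>polA\<^esub> {c, w}"
    and fg: "f * g \<in> Idl\<^bsub>polA\<^esub> {u, w}"
  shows "f \<in> Idl\<^bsub>polA\<^esub> {u, w} \<or> g \<in> Idl\<^bsub>polA\<^esub> {u, w}"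
proof -
  let ?P = "Idl\<^bsub>polA\<^esub> {u, w}"
  have c0: "c \<noteq> 0" using w(2) by auto
  have w_dvd: "w dvd x \<or> w dvd y" if "w dvd x * y" for x y
    using w(1) that prime_elem_dvd_multD by auto
  have w_c: "\<not> w dvd c ^ n" for n
  proof (induction n)
    case 0
    then show ?case using w(2) by (auto dest: dvd_trans)
  qed (use w_dvd w(2) in auto)
  have P: "ideal ?P polA"
    by (rule ring.genideal_ideal[OF ring_from_type_algebra]) simp
  (* c is a non-zero-divisor modulo (u, w) *)
  have cancel: "x \<in> ?P" if "c * x \<in> ?P" for x
  proof -
    obtain y z where yz: "c * x = y * u + z * w" using \<open>c * x \<in> ?P\<close> mem_Idl_pair by blast
    have "d * y = (x - y * Var i) * c + (- z) * w" using yz by (simp add: u_def algebra_simps)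
    then have "y \<in> Idl\<^bsub>polA\<^esub> {c, w}" using reg mem_Idl_pair by blast
    then obtain y1 y2 where y: "y = y1 * c + y2 * w" using mem_Idl_pair by blast
    have "c * (x - y1 * u) = w * (y2 * u + z)" using yz y by (simp add: algebra_simps)
    then have "w dvd x - y1 * u" using w_dvd w(2) by (metis dvd_triv_left)
    then obtain t where "x = y1 * u + t * w" by (metis add.commute diff_add_cancel dvdE mult.commute)
    then show ?thesis using mem_Idl_pair by blast
  qed
  have cancel: "x \<in> ?P" if "c ^ n * x \<in> ?P" for n x
    using that by (induction n) (auto simp: mult.assoc intro: cancel)
  have div: "\<exists>n r. pdiff i r = 0 \<and> u dvd c ^ n * f - r" for f
  proof -
    have "\<exists>s\<in>range (\<lambda>n. c ^ n). \<exists>r. indep {i} r \<and> s * f - r \<in> {f. u dvd f}"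
    proof (rule pseudo_division)
      show "ideal {f. u dvd f} polA" by (auto simp: ideal_polA_iff)
      show "1 \<in> range (\<lambda>n. c ^ n)" by (metis power_0 rangeI)
      show "s * t \<in> range (\<lambda>n. c ^ n)" if "s \<in> range (\<lambda>n. c ^ n)" "t \<in> range (\<lambda>n. c ^ n)" for s t
        using that by (auto simp flip: power_add)
      show "indep {i} s" if "s \<in> range (\<lambda>n. c ^ n)" for s
        using that free by (auto simp: indep_def pdiff_power)
      show "\<exists>s\<in>range (\<lambda>n. c ^ n). \<exists>r. indep {i} r \<and> s * Var j - r \<in> {f. u dvd f}" if "j \<in> {i}" for j
        by (intro bexI[of _ c] exI[of _ "- d"])
          (use free that in \<open>auto simp: indep_def u_def intro: range_eqI[of _ _ 1]\<close>)
    qed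
    then show ?thesis by (auto simp: indep_def)
  qed
  have u_free: "z = 0" if "pdiff i (u * z) = 0" for z
    using that linear_mult_free_imp_zero[of i c d] free c0 by (simp add: u_def)
  have uP: "x \<in> ?P" if "u dvd x" for x
  proof -
    obtain z where "x = u * z" using \<open>u dvd x\<close> by (elim dvdE)
    then have "x = z * u + 0 * w" by simp
    then show ?thesis using mem_Idl_pair by blast
  qed
  (* Clearing denominators replaces f and g by the X_i-free polynomials r and q. *)
  obtain k r l q where r: "pdiff i r = 0" "u dvd c ^ k * f - r" and q: "pdiff i q = 0" "u dvd c ^ l * g - q"
    using div by meson
  have "r * q = c ^ (k + l) * (f * g) - (c ^ l * g * (c ^ k * f - r) + r * (c ^ l * g - q))"
    by (simp add: algebra_simps power_add)
  also have "\<dots> \<in> ?P"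
  proof -
    have "c ^ l * g * (c ^ k * f - r) + r * (c ^ l * g - q) \<in> ?P"
      using r q P uP unfolding ideal_polA_iff by blast
    then show ?thesis using P fg unfolding ideal_polA_iff 
      by (metis add_uminus_conv_diff mult_minus1)
  qed
  finally obtain y z where yz: "r * q = y * u + z * w" using mem_Idl_pair by blast
  (* Making the cofactor of w free of X_i as well leaves an X_i-free multiple of u, which is zero. *)
  obtain n z' t where z': "pdiff i z' = 0" "c ^ n * z - z' = u * t" using div[of z] by (meson dvdE)
  have eq: "c ^ n * (r * q) - z' * w = u * (c ^ n * y + t * w)"
  proof -
    have "c ^ n * (r * q) - z' * w = c ^ n * y * u + (c ^ n * z - z') * w"
      unfolding yz by (simp add: algebra_simps)
    then show ?thesis unfolding z' by (simp add: algebra_simps)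
  qed
  have "pdiff i (c ^ n * (r * q) - z' * w) = 0"
    using free r q z' by (simp add: pdiff_mult pdiff_power)
  then have "c ^ n * y + t * w = 0" using u_free eq by metis
  then have "w dvd c ^ n * (r * q)" using eq by simp
  then have "w dvd r \<or> w dvd q" using w_dvd w_c by blast
  moreover have "x \<in> ?P" if "w dvd s" "u dvd c ^ m * x - s" for x s m
  proof (rule cancel)
    obtain a b where "s = w * a" "c ^ m * x - s = u * b" using \<open>w dvd s\<close> \<open>u dvd c ^ m * x - s\<close> by (meson dvdE)
    then have "c ^ m * x = b * u + a * w" by (simp add: algebra_simps)
    then show "c ^ m * x \<in> ?P" using mem_Idl_pair by blast
  qed
  ultimately show ?thesis using r q by blast
qed

lemma prime_elem_linear:
  fixes c d :: "'k::field_char_0 pol"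
  assumes "pdiff i c = 0" "pdiff i d = 0" "c \<noteq> 0" and reg: "\<And>z. c dvd d * z \<Longrightarrow> c dvd z"
  shows "prime_elem (c * Var i + d)"
proof -
  let ?u = "c * Var i + d"
  have mem: "x \<in> Idl\<^bsub>polA\<^esub> {y, 0} \<longleftrightarrow> y dvd x" for x y :: "'k pol"
    unfolding mem_Idl_pair by (auto simp: dvd_def mult.commute)
  have "\<not> ?u dvd 1"
  proof
    assume "?u dvd 1"
    then obtain z where "1 = ?u * z" by (elim dvdE)
    then show False using linear_mult_free_imp_zero[of i c d z] assms by (metis mult_zero_right one_neq_zero pdiff_one)
  qed
  moreover have "?u \<noteq> 0"
    using linear_mult_free_imp_zero[of i c d 1] assms(1-3) by (metis mult_1_right one_neq_zero pdiff_zero)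
  moreover have "?u dvd f \<or> ?u dvd g" if "?u dvd f * g" for f g
  proof (rule ideal_linear_pair_prime[of i c d 0 f g, unfolded mem])
    show "c dvd z" if "c dvd d * z" for z using that by (rule reg)
  qed (use assms(1-3) that in simp_all)
  ultimately show ?thesis by (auto simp: prime_elem_def)
qed

lemma prime_elem_Var: "prime_elem (Var i :: 'k::field_char_0 pol)"
  using prime_elem_linear[of i 1 0] by simp


section \<open>The bracket and Poisson ideals\<close>

lemma bracket_Var_left: "bracket (Var i) g = (\<Sum>j\<in>UNIV. pdiff j g * gen_bracket i j)"
proof -
  have "bracket (Var i) g = (\<Sum>k\<in>UNIV. if k = i then (\<Sum>j\<in>UNIV. pdiff j g * gen_bracket i j) else 0)"
    unfolding bracket_def by (intro sum.cong) (auto simp: pdiff_Var)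
  then show ?thesis by simp
qed

lemma bracket_eq_sum_Var: "bracket f g = (\<Sum>i\<in>UNIV. pdiff i f * bracket (Var i) g)"
  unfolding bracket_Var_left by (simp add: bracket_def sum_distrib_left mult.assoc)

lemma bracket_add_right: "bracket f (g + h) = bracket f g + bracket f h"
  unfolding bracket_def by (simp add: algebra_simps sum.distrib)

lemma bracket_diff_right: "bracket f (g - h) = bracket f g - bracket f h"
  unfolding bracket_def by (simp add: algebra_simps sum_subtractf)

lemma bracket_mult_right: "bracket f (g * h) = g * bracket f h + bracket f g * h"
  unfolding bracket_def by (simp add: pdiff_mult algebra_simps sum.distrib sum_distrib_left sum_distrib_right)

lemma bracket_Const_right: "bracket f (Const c) = 0"
  unfolding bracket_def by simp

lemma poisson_ideal_Idl_pair:
  assumes "\<And>f. bracket f u = 0" "\<And>f. bracket f w = 0"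
  shows "poisson_ideal (Idl\<^bsub>polA\<^esub> {u, w})"
  unfolding poisson_ideal_def
proof (intro conjI allI ballI)
  show "ideal (Idl\<^bsub>polA\<^esub> {u, w}) polA"
    by (rule ring.genideal_ideal[OF ring_from_type_algebra]) simp
  fix f g assume "g \<in> Idl\<^bsub>polA\<^esub> {u, w}"
  then obtain x y where "g = x * u + y * w" using mem_Idl_pair by blast
  then have "bracket f g = bracket f x * u + bracket f y * w"
    by (simp add: bracket_add_right bracket_mult_right assms)
  then show "bracket f g \<in> Idl\<^bsub>polA\<^esub> {u, w}" using mem_Idl_pair by blast
qed

lemma poisson_ideal_sum:
  assumes "poisson_ideal I" "poisson_ideal J"
  shows "poisson_ideal {x + y | x y. x \<in> I \<and> y \<in> J}" (is "poisson_ideal ?S")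
proof -
  have I: "0 \<in> I" "\<And>x y. x \<in> I \<Longrightarrow> y \<in> I \<Longrightarrow> x + y \<in> I" "\<And>a x. x \<in> I \<Longrightarrow> a * x \<in> I"
    "\<And>a x. x \<in> I \<Longrightarrow> bracket a x \<in> I"
    and J: "0 \<in> J" "\<And>x y. x \<in> J \<Longrightarrow> y \<in> J \<Longrightarrow> x + y \<in> J" "\<And>a x. x \<in> J \<Longrightarrow> a * x \<in> J"
    "\<And>a x. x \<in> J \<Longrightarrow> bracket a x \<in> J"
    using assms unfolding poisson_ideal_def ideal_polA_iff by blast+
  have mem: "x + y \<in> ?S" if "x \<in> I" "y \<in> J" for x y using that by blast
  show ?thesis
    unfolding poisson_ideal_def ideal_polA_iff
  proof (intro conjI ballI allI)
    show "0 \<in> ?S" using mem[OF I(1) J(1)] by simp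
  next
    fix s t assume "s \<in> ?S" "t \<in> ?S"
    then obtain x y x' y' where *: "s = x + y" "t = x' + y'" "x \<in> I" "y \<in> J" "x' \<in> I" "y' \<in> J"
      by blast
    have "s + t = (x + x') + (y + y')" using * by simp
    also have "\<dots> \<in> ?S" using mem I(2) J(2) * by blast
    finally show "s + t \<in> ?S" .
  next
    fix a s assume "s \<in> ?S"
    then obtain x y where *: "s = x + y" "x \<in> I" "y \<in> J" by blast
    then show "a * s \<in> ?S" "bracket a s \<in> ?S"
      using mem I(3,4) J(3,4) by (simp_all only: distrib_left bracket_add_right)
  qed
qed


section \<open>The central elements as affine polynomials in one variable\<close>

lemma twice_Omega1: "2 * Omega1 = 2 * X1 * X3 * X5 - 3 * X1 * X4 - X2 * X5 + X3 ^ 2"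
proof -
  have "2 * Omega1 = 2 * X1 * X3 * X5 - (2 * Const (3/2)) * X1 * X4 - (2 * Const (1/2)) * X2 * X5
      + (2 * Const (1/2)) * (X3 :: 'a pol) ^ 2"
    unfolding Omega1_def by (simp add: algebra_simps)
  moreover have "2 * Const (3/2 :: 'a) = 3" "2 * Const (1/2 :: 'a) = 1"
    by (simp_all flip: Const_numeral Const_mult)
  ultimately show ?thesis by simp
qed

lemma six_Omega2:
  "6 * Omega2 = 6 * X2 * X4 * X6 - 4 * X3 ^ 3 * X6 - 4 * X2 * X5 ^ 3
     + 12 * X3 ^ 2 * X5 ^ 2 - 18 * X3 * X4 * X5 + 9 * X4 ^ 2"
proof -
  have "6 * Omega2 = 6 * X2 * X4 * X6 - (6 * Const (2/3)) * X3 ^ 3 * X6 - (6 * Const (2/3)) * X2 * X5 ^ 3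
     + 12 * X3 ^ 2 * X5 ^ 2 - 18 * X3 * X4 * X5 + (6 * Const (3/2)) * (X4 :: 'a pol) ^ 2"
    unfolding Omega2_def by (simp add: algebra_simps)
  moreover have "6 * Const (2/3 :: 'a) = 4" "6 * Const (3/2 :: 'a) = 9"
    by (simp_all flip: Const_numeral Const_mult)
  ultimately show ?thesis by simp
qed

lemma bracket_Omega1: "bracket f Omega1 = 0"
proof -
  have "bracket (Var i) (2 * Omega1) = (0 :: 'a pol)" for i
    unfolding twice_Omega1
    by (cases i)
      (simp_all add: bracket_Var_left UNIV_idx gen_bracket_def pdiff_mult pdiff_power pdiff_Var
        algebra_simps power2_eq_square power3_eq_cube)
  then have "bracket f (2 * Omega1) = 0" unfolding bracket_eq_sum_Var[of f] by simp
  then show ?thesis using bracket_Const_right[of f 2] by (simp add: bracket_mult_right)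
qed

lemma bracket_Omega2: "bracket f Omega2 = 0"
proof -
  have "bracket (Var i) (6 * Omega2) = (0 :: 'a pol)" for i
    unfolding six_Omega2
    by (cases i)
      (simp_all add: bracket_Var_left UNIV_idx gen_bracket_def pdiff_mult pdiff_power pdiff_Var
        algebra_simps power2_eq_square power3_eq_cube)
  then have "bracket f (6 * Omega2) = 0" unfolding bracket_eq_sum_Var[of f] by simp
  then show ?thesis using bracket_Const_right[of f 6] by (simp add: bracket_mult_right)
qed

text \<open>
  The letters \<open>c\<close>, \<open>d\<close>, \<open>a\<close>, \<open>b\<close> of the introduction are, in this order, \<open>lead1\<close>, \<open>rest1 \<alpha>\<close>,
  \<open>lead2\<close>, \<open>rest2 \<beta>\<close>. The scaling by \<open>2\<close> and \<open>6\<close> clears the denominators in \<open>\<Omega>\<^sub>1\<close> and \<open>\<Omega>\<^sub>2\<close>.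
\<close>

definition lead1 :: "'k::field_char_0 pol" where
  "lead1 = - 3 * X4 + 2 * X3 * X5"

definition rest1 :: "'k \<Rightarrow> 'k::field_char_0 pol" where
  "rest1 \<alpha> = X3 ^ 2 - X2 * X5 - Const (2 * \<alpha>)"

definition lead2 :: "'k::field_char_0 pol" where
  "lead2 = 6 * X4 * X2 - 4 * X3 ^ 3"

definition rest2 :: "'k \<Rightarrow> 'k::field_char_0 pol" where
  "rest2 \<beta> = 12 * X3 ^ 2 * X5 ^ 2 + 9 * X4 ^ 2 - 4 * X2 * X5 ^ 3 - 18 * X3 * X4 * X5 - Const (6 * \<beta>)"

lemma linear_in_X1: "lead1 * X1 + rest1 \<alpha> = 2 * (Omega1 - Const \<alpha>)"
  unfolding right_diff_distrib twice_Omega1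
  by (simp add: lead1_def rest1_def Const_mult algebra_simps)

lemma linear_in_X6: "lead2 * X6 + rest2 \<beta> = 6 * (Omega2 - Const \<beta>)"
  unfolding right_diff_distrib six_Omega2
  by (simp add: lead2_def rest2_def Const_mult algebra_simps)

lemma Const_dvd: "c \<noteq> 0 \<Longrightarrow> Const c dvd f"
  by (rule dvdI[of _ _ "Const (1 / c) * f"]) (simp flip: mult.assoc Const_mult)

lemma Idl_scale:
  assumes "a \<noteq> 0" "b \<noteq> 0"
  shows "Idl\<^bsub>polA\<^esub> {Const a * u, Const b * w} = Idl\<^bsub>polA\<^esub> {u, w}"
proof (rule Set.set_eqI)
  fix f
  show "f \<in> Idl\<^bsub>polA\<^esub> {Const a * u, Const b * w} \<longleftrightarrow> f \<in> Idl\<^bsub>polA\<^esub> {u, w}"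
  proof
    assume "f \<in> Idl\<^bsub>polA\<^esub> {u, w}"
    then obtain x y where "f = x * u + y * w" using mem_Idl_pair by blast
    also have "\<dots> = (Const (1 / a) * Const a) * x * u + (Const (1 / b) * Const b) * y * w"
      using assms by (simp flip: Const_mult)
    also have "\<dots> = (Const (1 / a) * x) * (Const a * u) + (Const (1 / b) * y) * (Const b * w)"
      by (simp only: mult_ac)
    finally show "f \<in> Idl\<^bsub>polA\<^esub> {Const a * u, Const b * w}" using mem_Idl_pair by blast
  next
    assume "f \<in> Idl\<^bsub>polA\<^esub> {Const a * u, Const b * w}"
    then obtain x y where "f = x * (Const a * u) + y * (Const b * w)" using mem_Idl_pair by blast
    then have "f = (x * Const a) * u + (y * Const b) * w" by (simp add: mult.assoc)
    then show "f \<in> Idl\<^bsub>polA\<^esub> {u, w}" using mem_Idl_pair by blast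
  qed
qed

lemma Idl_Omega_eq:
  "Idl\<^bsub>polA\<^esub> {Omega1 - Const \<alpha>, Omega2 - Const \<beta>} =
   Idl\<^bsub>polA\<^esub> {lead1 * X1 + rest1 \<alpha>, lead2 * X6 + rest2 \<beta>}"
  unfolding linear_in_X1 linear_in_X6
  using Idl_scale[of 2 6 "Omega1 - Const \<alpha>" "Omega2 - Const \<beta>"] by simp


section \<open>Primality\<close>

lemma not_dvd_if_ev: "ev p f = 0 \<Longrightarrow> ev p g \<noteq> 0 \<Longrightarrow> \<not> f dvd g"
  by (auto elim!: dvdE)

text \<open>
  The primality proofs for single elements follow one pattern: the element is affine in some
  variable, and the coefficient of that variable is either a unit or a prime element that does not
  divide the constant term. Non-divisibility is read off at a point where only the supposed
  divisor vanishes.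
\<close>

lemma prime_elem_rest1: "prime_elem (rest1 \<alpha>)"
proof -
  let ?r = "X3 ^ 2 - Const (2 * \<alpha>)"
  have "\<not> X5 dvd ?r"
  proof (cases "\<alpha> = 0")
    case True
    then show ?thesis by (intro not_dvd_if_ev[of "\<lambda>i. if i = I3 then 1 else 0"]) simp_all
  next
    case False
    then show ?thesis by (intro not_dvd_if_ev[of "\<lambda>i. 0"]) simp_all
  qed
  then have "prime_elem ((- X5) * X2 + ?r)"
    using prime_elem_Var[of I5]
    by (intro prime_elem_linear)
      (auto simp: pdiff_Var pdiff_power dest: prime_elem_dvd_multD)
  then show ?thesis by (simp add: rest1_def algebra_simps)
qed

lemma prime_elem_lead1: "prime_elem lead1"
  unfolding lead1_def
  by (rule prime_elem_linear) (use Const_dvd[of "-3"] in \<open>simp_all add: pdiff_mult pdiff_Var Const_minus\<close>)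

lemma prime_elem_lead2: "prime_elem lead2"
proof -
  have "prime_elem (6 * X4 + 0 :: 'a pol)"
    by (rule prime_elem_linear) (use Const_dvd[of 6] in simp_all)
  moreover have "\<not> 6 * X4 dvd - (4 * X3 ^ 3 :: 'a pol)"
    by (rule not_dvd_if_ev[of "\<lambda>i. if i = I3 then 1 else 0"]) simp_all
  ultimately have "prime_elem ((6 * X4) * X2 + (- (4 * X3 ^ 3)) :: 'a pol)"
    by (intro prime_elem_linear)
      (auto simp: pdiff_Var pdiff_mult pdiff_power dest: prime_elem_dvd_multD)
  then show ?thesis by (simp add: lead2_def)
qed

lemma prime_elem_linear_in_X6: "prime_elem (lead2 * X6 + rest2 \<beta>)"
proof (rule prime_elem_linear)
  (* At this point lead2 vanishes and rest2 has the value 1. *)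
  have "\<not> lead2 dvd rest2 \<beta>"
    by (rule not_dvd_if_ev[of "case_idx 0 (- (6 * \<beta> + 1) / 4) 0 0 1 0"])
      (simp_all add: lead2_def rest2_def field_simps)
  then show "lead2 dvd z" if "lead2 dvd rest2 \<beta> * z" for z
    using that prime_elem_lead2 by (auto dest: prime_elem_dvd_multD)
  show "lead2 \<noteq> (0 :: 'a pol)" by (rule prime_elem_not_zeroI[OF prime_elem_lead2])
qed (simp_all add: lead2_def rest2_def pdiff_mult pdiff_power pdiff_Var)

text \<open>
  Up to sign, the remainder of \<open>6 (\<Omega>\<^sub>2 - \<beta>)\<close> modulo \<open>lead1\<close> and \<open>rest1 \<alpha>\<close>. Modulo \<open>lead1\<close> the
  polynomial \<open>6 \<Omega>\<^sub>2\<close> becomes \<open>4 (X\<^sub>2 X\<^sub>5 - X\<^sub>3\<^sup>2) (X\<^sub>3 X\<^sub>6 - X\<^sub>5\<^sup>2)\<close>, whose first factor is \<open>- 2 \<alpha>\<close>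
  modulo \<open>rest1 \<alpha>\<close>.
\<close>

definition defect :: "'k \<Rightarrow> 'k \<Rightarrow> 'k::field_char_0 pol" where
  "defect \<alpha> \<beta> = Const (8 * \<alpha>) * (X3 * X6 - X5 ^ 2) + Const (6 * \<beta>)"

lemma linear_in_X6_mod_lead1:
  "lead2 * X6 + rest2 \<beta> =
     (- 2 * X2 * X6 - 3 * X4 + 4 * X3 * X5) * lead1 - 4 * (X3 * X6 - X5 ^ 2) * rest1 \<alpha> - defect \<alpha> \<beta>"
  by (simp add: lead1_def lead2_def rest1_def rest2_def defect_def Const_mult algebra_simps
      power2_eq_square power3_eq_cube)

text \<open>
  The coefficient of \<open>X\<^sub>4\<close> in \<open>lead1\<close> is a unit, so \<open>lead1\<close> merely eliminates \<open>X\<^sub>4\<close>, which does not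
  occur in the prime element \<open>rest1 \<alpha>\<close>.
\<close>

lemma ideal_lead1_rest1_prime:
  assumes "f * g \<in> Idl\<^bsub>polA\<^esub> {lead1, rest1 \<alpha>}"
  shows "f \<in> Idl\<^bsub>polA\<^esub> {lead1, rest1 \<alpha>} \<or> g \<in> Idl\<^bsub>polA\<^esub> {lead1, rest1 \<alpha>}"
  using assms unfolding lead1_def
proof (rule ideal_linear_pair_prime[rotated -1])
  show "\<not> rest1 \<alpha> dvd - 3"
    by (rule not_dvd_if_ev[of "case_idx 0 (- 2 * \<alpha>) 0 0 1 0"]) (simp_all add: rest1_def)
  show "rest1 \<alpha> = 0 \<or> prime_elem (rest1 \<alpha>)" by (simp add: prime_elem_rest1)
  fix z
  have "z = (Const (- 1 / 3) * z) * (- 3) + 0 * rest1 \<alpha>"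
    by (simp flip: Const_numeral Const_minus Const_mult)
  then show "z \<in> Idl\<^bsub>polA\<^esub> {- 3, rest1 \<alpha>}" using mem_Idl_pair by blast
qed (simp_all add: rest1_def pdiff_mult pdiff_power pdiff_Var)

text \<open>
  On the zero set of \<open>lead1\<close> and \<open>rest1 \<alpha>\<close> the variable \<open>X\<^sub>6\<close> is unconstrained. So for \<open>\<alpha> \<noteq> 0\<close> it can
  be chosen to give \<open>defect \<alpha> \<beta>\<close> the value \<open>1\<close>, and for \<open>\<alpha> = 0\<close> the defect is the constant
  \<open>6 \<beta> \<noteq> 0\<close>.
\<close>

lemma defect_notin:
  assumes "(\<alpha>, \<beta>) \<noteq> (0, 0)"
  shows "defect \<alpha> \<beta> \<notin> Idl\<^bsub>polA\<^esub> {lead1, rest1 \<alpha>}"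
proof
  (* lead1 and rest1 vanish by the choice of X4 and X2, and X3 = X5 = 1 makes the factor of 8 \<alpha>
     in the defect equal to X6 - 1. *)
  define p where "p = case_idx 0 (1 - 2 * \<alpha>) 1 (2 / 3) 1 (if \<alpha> = 0 then 0 else 1 + (1 - 6 * \<beta>) / (8 * \<alpha>))"
  assume "defect \<alpha> \<beta> \<in> Idl\<^bsub>polA\<^esub> {lead1, rest1 \<alpha>}"
  then obtain x y where "defect \<alpha> \<beta> = x * lead1 + y * rest1 \<alpha>" using mem_Idl_pair by blast
  then have "ev p (defect \<alpha> \<beta>) = ev p x * ev p lead1 + ev p y * ev p (rest1 \<alpha>)" by simp
  moreover have "ev p lead1 = 0" "ev p (rest1 \<alpha>) = 0" by (simp_all add: p_def lead1_def rest1_def)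
  moreover have "ev p (defect \<alpha> \<beta>) \<noteq> 0" using assms by (auto simp: p_def defect_def)
  ultimately show False by simp
qed

text \<open>
  Let \<open>w = 6 (\<Omega>\<^sub>2 - \<beta>)\<close>. A relation \<open>rest1 \<alpha> * z = x * lead1 + y * w\<close> shows that \<open>y * defect \<alpha> \<beta>\<close>
  lies in the prime ideal of \<open>lead1\<close> and \<open>rest1 \<alpha>\<close>, hence so does \<open>y\<close>. Substituting such a
  representation of \<open>y\<close> makes \<open>lead1\<close> divide \<open>rest1 \<alpha>\<close> times a polynomial congruent to \<open>z\<close>
  modulo \<open>w\<close>, and \<open>lead1\<close> is prime.
\<close>

lemma ideal_Omega_prime:
  assumes nz: "(\<alpha>, \<beta>) \<noteq> (0, 0)"
    and fg: "f * g \<in> Idl\<^bsub>polA\<^esub> {lead1 * X1 + rest1 \<alpha>, lead2 * X6 + rest2 \<beta>}"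
  shows "f \<in> Idl\<^bsub>polA\<^esub> {lead1 * X1 + rest1 \<alpha>, lead2 * X6 + rest2 \<beta>} \<or>
         g \<in> Idl\<^bsub>polA\<^esub> {lead1 * X1 + rest1 \<alpha>, lead2 * X6 + rest2 \<beta>}"
  using fg
proof (rule ideal_linear_pair_prime[rotated -1])
  let ?w = "lead2 * X6 + rest2 \<beta>" and ?c = lead1 and ?d = "rest1 \<alpha>"
  let ?m = "4 * (X3 * X6 - X5 ^ 2) :: 'a pol" and ?q = "- 2 * X2 * X6 - 3 * X4 + 4 * X3 * X5 :: 'a pol"
  (* A zero of w at which lead1 has the value - 3 *)
  show "\<not> ?w dvd ?c"
    by (rule not_dvd_if_ev[of "case_idx 0 1 0 1 0 (\<beta> - 3 / 2)"])
      (simp_all add: lead1_def lead2_def rest2_def)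
  show "?w = 0 \<or> prime_elem ?w" by (simp add: prime_elem_linear_in_X6)
  fix z assume "?d * z \<in> Idl\<^bsub>polA\<^esub> {?c, ?w}"
  then obtain x y where xy: "?d * z = x * ?c + y * ?w" using mem_Idl_pair by blast
  have "y * defect \<alpha> \<beta> = (x + y * ?q) * ?c + (- (z + y * ?m)) * ?d"
    using xy unfolding linear_in_X6_mod_lead1[of \<beta> \<alpha>] by (simp add: algebra_simps)
  then have "y * defect \<alpha> \<beta> \<in> Idl\<^bsub>polA\<^esub> {?c, ?d}" using mem_Idl_pair by blast
  then have "y \<in> Idl\<^bsub>polA\<^esub> {?c, ?d}" using ideal_lead1_rest1_prime defect_notin[OF nz] by blast
  then obtain y1 y2 where y: "y = y1 * ?c + y2 * ?d" using mem_Idl_pair by blast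
  have "?d * (z - y2 * ?w) = ?c * (x + y1 * ?w)" using xy y by (simp add: algebra_simps)
  then have "?c dvd ?d * (z - y2 * ?w)" by simp
  (* A zero of lead1 at which rest1 has the value - 1 *)
  moreover have "\<not> ?c dvd ?d"
    by (rule not_dvd_if_ev[of "case_idx 0 (1 - 2 * \<alpha>) 0 0 1 0"]) (simp_all add: lead1_def rest1_def)
  ultimately have "?c dvd z - y2 * ?w" using prime_elem_lead1 by (auto dest: prime_elem_dvd_multD)
  then obtain t where "z - y2 * ?w = ?c * t" by (elim dvdE)
  then have "z = t * ?c + y2 * ?w" by (simp add: algebra_simps)
  then show "z \<in> Idl\<^bsub>polA\<^esub> {?c, ?w}" using mem_Idl_pair by blast
qed (simp_all add: lead1_def lead2_def rest1_def rest2_def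
    pdiff_mult pdiff_power pdiff_Var)


section \<open>Poisson ideals inside the ideal of a point\<close>

text \<open>
  On polynomials in \<open>X\<^sub>2, \<dots>, X\<^sub>5\<close> the Hamiltonian derivations \<open>{X\<^sub>i, -}\<close> with \<open>2 \<le> i \<le> 5\<close> are the
  partial derivatives transformed by the skew-symmetric matrix \<open>\<Pi> = ({X\<^sub>i, X\<^sub>j})\<close>. This
  \<open>4 \<times> 4\<close> matrix is inverted up to its Pfaffian \<open>\<Pi>\<^sub>2\<^sub>3 \<Pi>\<^sub>4\<^sub>5 - \<Pi>\<^sub>2\<^sub>4 \<Pi>\<^sub>3\<^sub>5 + \<Pi>\<^sub>2\<^sub>5 \<Pi>\<^sub>3\<^sub>4\<close> by the
  matrix of complementary entries, and the Pfaffian factors as half of \<open>lead1 * lead2\<close>: the Poisson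
  structure has full rank exactly where both elimination steps can be carried out.
\<close>

lemma pfaffian_mult_pdiff:
  assumes "indep {I1, I6} f"
  shows "\<exists>a. lead1 * lead2 * pdiff j f = (\<Sum>i\<in>UNIV. a i * bracket (Var i) f)"
proof -
  let ?g = gen_bracket
  (* Twice the rows of the matrix of complementary entries; the derivatives by X1 and X6 vanish. *)
  let ?a = "\<lambda>j. case j of
      I2 \<Rightarrow> case_idx 0 0 (- 2 * ?g I4 I5) (2 * ?g I3 I5) (- 2 * ?g I3 I4) 0
    | I3 \<Rightarrow> case_idx 0 (2 * ?g I4 I5) 0 (- 2 * ?g I2 I5) (2 * ?g I2 I4) 0
    | I4 \<Rightarrow> case_idx 0 (- 2 * ?g I3 I5) (2 * ?g I2 I5) 0 (- 2 * ?g I2 I3) 0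
    | I5 \<Rightarrow> case_idx 0 (2 * ?g I3 I4) (- 2 * ?g I2 I4) (2 * ?g I2 I3) 0 0
    | _ \<Rightarrow> (\<lambda>_. 0)"
  have "lead1 * lead2 * pdiff j f = (\<Sum>i\<in>UNIV. ?a j i * bracket (Var i) f)"
    using assms
    by (cases j) (simp_all add: bracket_Var_left UNIV_idx indep_def gen_bracket_def lead1_def lead2_def
      algebra_simps power2_eq_square power3_eq_cube)
  then show ?thesis by blast
qed

text \<open>
  The polynomials free of \<open>X\<^sub>1\<close> and \<open>X\<^sub>6\<close> that lie in \<open>Q\<close> up to a factor not vanishing at \<open>p\<close> are
  closed under partial derivatives, since the Pfaffian does not vanish at \<open>p\<close>. If there were a
  nonzero one, differentiation would lead to a nonzero constant, hence to an element of \<open>Q\<close> not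
  vanishing at \<open>p\<close>.
\<close>

lemma indep_in_poisson_ideal_imp_zero:
  assumes Q: "poisson_ideal Q" "\<And>f. f \<in> Q \<Longrightarrow> ev p f = 0"
    and p: "ev p lead1 \<noteq> 0" "ev p lead2 \<noteq> 0"
    and r: "r \<in> Q" "indep {I1, I6} r"
  shows "r = 0"
proof (rule ccontr)
  assume "r \<noteq> 0"
  have Q_add: "x + y \<in> Q" if "x \<in> Q" "y \<in> Q" for x y
    using Q(1) that unfolding poisson_ideal_def ideal_polA_iff by blast
  have Q_mult: "a * x \<in> Q" and Q_bracket: "bracket a x \<in> Q" if "x \<in> Q" for a x
    using Q(1) that unfolding poisson_ideal_def ideal_polA_iff by blast+
  have Q_diff: "x - y \<in> Q" if "x \<in> Q" "y \<in> Q" for x y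
    using Q_add[OF that(1) Q_mult[OF that(2), of "-1"]] by simp
  define J where "J f \<longleftrightarrow> indep {I1, I6} f \<and> (\<exists>s. ev p s \<noteq> 0 \<and> s * f \<in> Q)" for f
  have "J r" using r unfolding J_def by (auto intro: exI[of _ 1])
  have J_pdiff: "J (pdiff j f)" if "J f" for j f
  proof -
    obtain s where f: "indep {I1, I6} f" and s: "ev p s \<noteq> 0" "s * f \<in> Q"
      using \<open>J f\<close> unfolding J_def by blast
    (* From s f in Q the Leibniz rule leaves the error term f {X_i, s}, which one more factor s absorbs. *)
    have h: "s ^ 2 * bracket (Var i) f \<in> Q" for i
    proof -
      have "s * bracket (Var i) (s * f) - bracket (Var i) s * (s * f) \<in> Q"
        by (rule Q_diff[OF Q_mult[OF Q_bracket[OF s(2)]] Q_mult[OF s(2)]])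
      also have "s * bracket (Var i) (s * f) - bracket (Var i) s * (s * f) = s ^ 2 * bracket (Var i) f"
        by (simp add: bracket_mult_right algebra_simps power2_eq_square)
      finally show ?thesis .
    qed
    obtain a where a: "lead1 * lead2 * pdiff j f = (\<Sum>i\<in>UNIV. a i * bracket (Var i) f)"
      using pfaffian_mult_pdiff[OF f] by blast
    have "s ^ 2 * (lead1 * lead2 * pdiff j f) = (\<Sum>i\<in>UNIV. a i * (s ^ 2 * bracket (Var i) f))"
      unfolding a sum_distrib_left by (simp only: mult_ac)
    also have "\<dots> \<in> Q" unfolding UNIV_idx by simp (intro Q_add Q_mult h)
    finally have "s ^ 2 * (lead1 * lead2 * pdiff j f) \<in> Q" .
    then have "(s ^ 2 * lead1 * lead2) * pdiff j f \<in> Q" by (simp add: mult.assoc)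
    moreover have "ev p (s ^ 2 * lead1 * lead2) \<noteq> 0" using s(1) p by simp
    moreover have "indep {I1, I6} (pdiff j f)"
      using f unfolding indep_def by (simp add: pdiff_commute[of _ j])
    ultimately show ?thesis unfolding J_def by blast
  qed
  obtain g where g: "J g" "g \<noteq> 0" "\<And>i. pdiff i g = 0"
    using ex_nonzero_with_all_pdiff_zero[where S = J and V = UNIV, OF \<open>r \<noteq> 0\<close> \<open>J r\<close> J_pdiff] by blast
  then obtain c where c: "g = Const c" using eq_Const_if_all_pdiff_zero by blast
  then have "c \<noteq> 0" using g(2) by auto
  obtain s where "ev p s \<noteq> 0" "s * g \<in> Q" using g(1) unfolding J_def by blast
  then show False using Q(2)[of "s * g"] c \<open>c \<noteq> 0\<close> by simp
qed

lemma maximalideal_ev: "maximalideal {f. ev p f = 0} polA"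
proof (rule maximalidealI)
  show "ideal {f. ev p f = 0} polA" by (simp add: ideal_polA_iff)
  have "ev p 1 \<noteq> 0" by simp
  then show "carrier polA \<noteq> {f. ev p f = 0}" by (metis mem_Collect_eq polA_simps(1) UNIV_I)
  fix J assume J: "ideal J polA" "{f. ev p f = 0} \<subseteq> J"
  show "J = {f. ev p f = 0} \<or> J = carrier polA"
  proof (cases "J \<subseteq> {f. ev p f = 0}")
    case False
    then obtain f where f: "f \<in> J" "ev p f \<noteq> 0" by blast
    have "Const (1 / ev p f) * f \<in> J" "1 - Const (1 / ev p f) * f \<in> J"
      using J f unfolding ideal_polA_iff by auto
    then have "1 \<in> J" using J(1) unfolding ideal_polA_iff by (metis add_diff_cancel_left' add_diff_eq)
    then have "x \<in> J" for x using J(1) unfolding ideal_polA_iff by (metis mult_1_right)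
    then show ?thesis by auto
  qed (use J in auto)
qed


section \<open>Poisson primitivity\<close>

theorem corollary4p11:
  fixes \<alpha> \<beta> :: "'k::field_char_0"
  assumes "(\<alpha>, \<beta>) \<noteq> (0, 0)"
  shows "poisson_primitive (Idl\<^bsub>polA\<^esub> {Omega1 - Const \<alpha>, Omega2 - Const \<beta>})"
proof -
  define P where "P = Idl\<^bsub>polA\<^esub> {Omega1 - Const \<alpha>, Omega2 - Const \<beta>}"
  (* On X2 = X4 = 1, X3 = X5 = 0 the equations read - 3 X1 = 2 \<alpha> and 6 X6 + 9 = 6 \<beta>. *)
  define p where "p = case_idx (- 2 * \<alpha> / 3) 1 0 1 0 (\<beta> - 3 / 2)"
  define M where "M = {f. ev p f = 0}"
  have M: "maximalideal M polA" unfolding M_def by (rule maximalideal_ev)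
  have p: "ev p lead1 \<noteq> 0" "ev p lead2 \<noteq> 0" by (simp_all add: p_def lead1_def lead2_def)
  have P: "poisson_ideal P"
    unfolding P_def
    by (rule poisson_ideal_Idl_pair)
      (simp_all add: bracket_diff_right bracket_Const_right bracket_Omega1 bracket_Omega2)
  have "ev p (Omega1 - Const \<alpha>) = 0" "ev p (Omega2 - Const \<beta>) = 0"
    by (simp_all add: p_def Omega1_def Omega2_def)
  then have PM: "P \<subseteq> M"
    by (auto simp: P_def M_def mem_Idl_pair)
  have P_split: "f \<in> P \<or> g \<in> P" if "f * g \<in> P" for f g
    using that ideal_Omega_prime[OF assms] unfolding P_def Idl_Omega_eq by blast
  have "1 \<notin> P" using PM by (auto simp: M_def)
  then have "primeideal P polA"
    using P P_split unfolding poisson_ideal_def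
    by (intro primeidealI cring_from_type_algebra) auto
  then have "poisson_prime P" using P unfolding poisson_prime_def by blast
  moreover have "Q \<subseteq> P" if Q: "poisson_prime Q" "Q \<subseteq> M" for Q
  proof
    fix f assume "f \<in> Q"
    define S where "S = {s. indep {I1, I6} s \<and> ev p s \<noteq> 0}"
    have lin: "lead1 * X1 - (- rest1 \<alpha>) \<in> P" "lead2 * X6 - (- rest2 \<beta>) \<in> P"
      unfolding P_def Idl_Omega_eq
      using ring.genideal_self[OF ring_from_type_algebra, of "{lead1 * X1 + rest1 \<alpha>, lead2 * X6 + rest2 \<beta>}"]
      by auto
    have "\<exists>s\<in>S. \<exists>r. indep {I1, I6} r \<and> s * f - r \<in> P"
    proof (rule pseudo_division)
      show "ideal P polA" using P by (simp add: poisson_ideal_def)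
      fix i assume "i \<in> {I1, I6}"
      then show "\<exists>s\<in>S. \<exists>r. indep {I1, I6} r \<and> s * Var i - r \<in> P"
      proof
        assume "i = I1"
        then show ?thesis
          using p lin by (intro bexI[of _ lead1] exI[of _ "- rest1 \<alpha>"])
            (auto simp: S_def lead1_def rest1_def)
      next
        assume "i \<in> {I6}"
        then show ?thesis
          using p lin by (intro bexI[of _ lead2] exI[of _ "- rest2 \<beta>"])
            (auto simp: S_def lead2_def rest2_def)
      qed
    qed (auto simp: S_def)
    then obtain s r where s: "ev p s \<noteq> 0" and r: "indep {I1, I6} r" "s * f - r \<in> P"
      by (auto simp: S_def)
    (* Enlarging Q by P keeps it a Poisson ideal inside M and makes it contain r. *)
    define T where "T = {x + y | x y. x \<in> Q \<and> y \<in> P}"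
    have "poisson_ideal T"
      unfolding T_def using Q P by (intro poisson_ideal_sum) (simp_all add: poisson_prime_def)
    moreover have "ev p t = 0" if t: "t \<in> T" for t
    proof -
      obtain x y where "t = x + y" "x \<in> M" "y \<in> M" using t Q(2) PM unfolding T_def by blast
      then show ?thesis by (simp add: M_def)
    qed
    moreover have "r \<in> T"
    proof -
      have "s * f \<in> Q" "- 1 * (s * f - r) \<in> P"
        using Q(1) P \<open>f \<in> Q\<close> r(2) unfolding poisson_prime_def poisson_ideal_def ideal_polA_iff by blast+
      moreover have "r = s * f + - 1 * (s * f - r)" by simp
      ultimately show ?thesis unfolding T_def by blast
    qed
    ultimately have "r = 0" using indep_in_poisson_ideal_imp_zero p r(1) by blast
    then have "s * f \<in> P" using r(2) by simp
    moreover have "s \<notin> P" using s PM by (auto simp: M_def)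
    ultimately show "f \<in> P" using P_split by blast
  qed
  ultimately show ?thesis
    unfolding poisson_primitive_def P_def[symmetric] using M PM by blast
qed

end
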